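(* Let $\varphi:\mathbb{R}^2\to[0,\infty)$ be a stationary and ergodic random field with marginal distribution function $\Phi$, let $\lambda\ge0$, and let $K$ and $K'$ be compact subsets of $\mathbb{R}^2$. Then $$\mathbf{P}_\lambda\Big(\exists (x,z)\in\eta \text{ with } x\notin K':\ B(x,\varphi(x))\cap K\neq\emptyset\Big)\ \le\ \mathbb{P}_\lambda\Big(\exists (x,z)\in\eta\text{ with }x\notin K':\ B(x,\Phi^{-1}(z))\cap K\neq\emptyset\Big).$$
   Context: Let $\eta$ be a homogeneous Poisson point process on $\mathbb{R}^2\times[0,1]$ with intensity $\lambda$, identified with its support, with law $\mathbb{P}_\lambda$. Let $\varphi$ be a random field with law $\overline{\mathbb{P}}$, independent of $\eta$; $\mathbf{P}_\lambda=\mathbb{P}_\lambda\times\overline{\mathbb{P}}$. The field is taken to be jointly measurable in (randomness, position), and $\mathbf{P}_\lambda$ to be completed, so that all events considered are measurable. Stationary: finite-dimensional distributions are invariant under all translations. Ergodic: every event in the $\sigma$-algebra generated by the evaluation maps $\varphi\mapsto\varphi(x)$ that is invariant under all shifts $\varphi(\cdot)\mapsto\varphi(\cdot-x)$, $x\in\mathbb{R}^2$, has probability $0$ or $1$. $\Phi(x)=\overline{\mathbb{P}}(\varphi(0)\le x)$ and $\Phi^{-1}(z)=\inf\{x\in\mathbb{R}:\Phi(x)\ge z\}$. $B(x,r)$ is the closed Euclidean disc of radius $r$ centred at $x$. *)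

theory Defs
  imports "HOL-Probability.Probability"
begin

(* A point process is represented by its random support.  Local finiteness is required
   for every outcome, so `card' below never counts an infinite set.  The Poisson weights
   are written out because `poisson_pmf' is only specified for a positive rate,
   whereas lam = 0 and null sets A are allowed here. *)

locale marked_poisson_process = prob_space P
  for P :: "'w measure" +
  fixes lam :: real and eta :: "'w \<Rightarrow> ((real^2) \<times> real) set"
  assumes intensity_nonneg: "0 \<le> lam"
    and points_in: "\<And>\<omega>. \<omega> \<in> space P \<Longrightarrow> eta \<omega> \<subseteq> UNIV \<times> {0..1}"
    and locally_finite: "\<And>\<omega> A. \<omega> \<in> space P \<Longrightarrow> bounded A \<Longrightarrow> finite (eta \<omega> \<inter> A)"
    and count_measurable: "\<And>A. A \<in> sets borel \<Longrightarrow> bounded A \<Longrightarrow>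
          (\<lambda>\<omega>. card (eta \<omega> \<inter> A)) \<in> measurable P (count_space UNIV)"
    and count_poisson: "\<And>A k. A \<in> sets borel \<Longrightarrow> bounded A \<Longrightarrow> A \<subseteq> UNIV \<times> {0..1} \<Longrightarrow>
          prob {\<omega> \<in> space P. card (eta \<omega> \<inter> A) = k}
            = (lam * measure lborel A) ^ k / fact k * exp (- (lam * measure lborel A))"
    and count_indep: "\<And>(A :: nat \<Rightarrow> ((real^2) \<times> real) set) I. finite I \<Longrightarrow>
          (\<And>i. i \<in> I \<Longrightarrow> A i \<in> sets borel \<and> bounded (A i) \<and> A i \<subseteq> UNIV \<times> {0..1}) \<Longrightarrow>
          disjoint_family_on A I \<Longrightarrow>
          indep_vars (\<lambda>_. count_space UNIV) (\<lambda>i \<omega>. card (eta \<omega> \<inter> A i)) I"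

definition shift :: "real^2 \<Rightarrow> (real^2 \<Rightarrow> real) \<Rightarrow> (real^2 \<Rightarrow> real)" where
  "shift t f = (\<lambda>x. f (x - t))"

(* S is the path space of the field, on which the shifts act.  It is kept arbitrary because
   ergodicity refers to it: on the space of all functions a set in the evaluation
   sigma-algebra depends on countably many coordinates only, and is therefore shift-invariant
   only if it is trivial. *)

locale random_field = prob_space Q
  for Q :: "'v measure" +
  fixes S :: "(real^2 \<Rightarrow> real) set" and phi :: "'v \<Rightarrow> real^2 \<Rightarrow> real"
  assumes path_nonneg: "\<And>f x. f \<in> S \<Longrightarrow> 0 \<le> f x"
    and path_shift: "\<And>f t. f \<in> S \<Longrightarrow> shift t f \<in> S"
    and paths: "\<And>\<omega>. \<omega> \<in> space Q \<Longrightarrow> phi \<omega> \<in> S"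
    and jointly_measurable:
      "(\<lambda>(\<omega>, x). phi \<omega> x) \<in> measurable (Q \<Otimes>\<^sub>M (borel :: (real^2) measure)) borel"
begin

definition evaluation_algebra :: "(real^2 \<Rightarrow> real) measure" where
  "evaluation_algebra = sigma S {{f \<in> S. f x \<in> B} | x B. B \<in> sets borel}"

definition stationary :: bool where
  "stationary \<longleftrightarrow> (\<forall>I t. finite I \<longrightarrow>
     distr Q (\<Pi>\<^sub>M x\<in>I. borel) (\<lambda>\<omega>. restrict (shift t (phi \<omega>)) I)
       = distr Q (\<Pi>\<^sub>M x\<in>I. borel) (\<lambda>\<omega>. restrict (phi \<omega>) I))"

definition ergodic :: bool where
  "ergodic \<longleftrightarrow> (\<forall>E \<in> sets evaluation_algebra.
     (\<forall>t. {f \<in> S. shift t f \<in> E} = E) \<longrightarrow>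
     prob {\<omega> \<in> space Q. phi \<omega> \<in> E} = 0 \<or> prob {\<omega> \<in> space Q. phi \<omega> \<in> E} = 1)"

definition marginal_cdf :: "real \<Rightarrow> real" where
  "marginal_cdf = cdf (distr Q borel (\<lambda>\<omega>. phi \<omega> 0))"

end

(* Extended-real valued: the infimum over the reals is -infinity at z = 0 (with empty disc), and
   +infinity at z = 1 (with the whole plane as disc) if F stays below 1. *)

definition quantile :: "(real \<Rightarrow> real) \<Rightarrow> real \<Rightarrow> ereal" where
  "quantile F z = Inf (ereal ` {x. z \<le> F x})"

definition ecball :: "real^2 \<Rightarrow> ereal \<Rightarrow> (real^2) set" where
  "ecball x r = {y. ereal (dist x y) \<le> r}"

end

theory Submission
  imports Defs
begin

text \<open>
  Given the field, the points of the process hitting \<open>K\<close> lie in a fixed region, so the conditional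
  hitting probability is \<open>1 - exp (- lam * a)\<close> with \<open>a\<close> the random area of
  \<open>{x. x \<notin> K' \<and> infdist x K \<le> phi \<omega> x}\<close>. By stationarity and Tonelli the mean
  of \<open>a\<close> is at most the volume of the set of marked points hitting \<open>K\<close> when the radius at \<open>(x, z)\<close> is
  \<open>quantile F z\<close>, since \<open>quantile F\<close> of a uniform mark has the law of \<open>phi \<omega> 0\<close>; concavity of
  \<open>a \<mapsto> 1 - exp (- lam * a)\<close> concludes. Everything is done in bounded windows, which exhaust the
  plane, so that all volumes are finite.
\<close>

section \<open>Discs meeting \<open>K\<close>, the quantile function, and a Jensen-type
  bound\<close>

text \<open>A nonempty closed set has a point nearest to \<open>x\<close>, so the infimum in
  \<open>infdist\<close> is attained. Nonemptiness matters: \<open>infdist x {}\<close> is 0 by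
  convention.\<close>

lemma ecball_Int_nonempty_iff:
  assumes "closed K" "K \<noteq> {}"
  shows "ecball x r \<inter> K \<noteq> {} \<longleftrightarrow> ereal (infdist x K) \<le> r"
proof
  assume "ecball x r \<inter> K \<noteq> {}"
  then obtain y where y: "y \<in> K" "ereal (dist x y) \<le> r"
    by (auto simp: ecball_def)
  have "ereal (infdist x K) \<le> ereal (dist x y)"
    using infdist_le[OF y(1)] by simp
  then show "ereal (infdist x K) \<le> r" using y(2) by (rule order_trans)
next
  assume *: "ereal (infdist x K) \<le> r"
  obtain y where "y \<in> K" "infdist x K = dist x y"
    using infdist_attains_inf[OF assms] by blast
  with * show "ecball x r \<inter> K \<noteq> {}" by (auto simp: ecball_def)
qed

lemma cball_Int_nonempty_iff:
  fixes K :: "(real^2) set"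
  assumes "closed K" "K \<noteq> {}"
  shows "cball x r \<inter> K \<noteq> {} \<longleftrightarrow> infdist x K \<le> r"
proof -
  have "cball x r = ecball x (ereal r)" by (auto simp: ecball_def)
  then show ?thesis using ecball_Int_nonempty_iff[OF assms] by simp
qed

lemma mono_quantile: "mono (quantile F)"
  unfolding quantile_def by (intro monoI Inf_superset_mono image_mono) auto

text \<open>Strict superlevel sets of a monotone function on the line are intervals.\<close>

lemma borel_measurable_quantile [measurable]: "quantile F \<in> borel_measurable borel"
proof (rule borel_measurableI_greater)
  fix y
  have "is_interval {z. y < quantile F z}"
    using mono_quantile[of F] unfolding is_interval_1 mono_def
    by (auto intro: less_le_trans)
  then have "{z. y < quantile F z} \<in> sets borel"
    by (rule real_interval_borel_measurable)
  then show "{z \<in> space borel. y < quantile F z} \<in> sets borel" by simp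
qed

text \<open>Jensen's inequality by way of the tangent at \<open>m\<close>, which lies above the
  concave graph. Its slope is nonnegative, so a bound on the mean of \<open>a\<close> is
  enough.\<close>

lemma (in prob_space) expectation_one_minus_exp_le:
  fixes a :: "'a \<Rightarrow> real"
  assumes a: "integrable M a" "\<And>x. x \<in> space M \<Longrightarrow> 0 \<le> a x"
    and "expectation a \<le> m" "0 \<le> l"
  shows "expectation (\<lambda>x. 1 - exp (- (l * a x))) \<le> 1 - exp (- (l * m))"
proof -
  note [measurable] = borel_measurable_integrable[OF a(1)]
  have tangent: "1 - exp (- (l * s)) \<le> 1 - exp (- (l * m)) + exp (- (l * m)) * (l * (s - m))" for s
  proof -
    \<comment> \<open>This is \<open>1 + u \<le> exp u\<close> at
      \<open>u = - (l * (s - m))\<close>, scaled by \<open>exp (- (l * m))\<close>.\<close>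
    have "exp (- (l * m)) * (1 + (- (l * (s - m)))) \<le> exp (- (l * m)) * exp (- (l * (s - m)))"
      by (intro mult_left_mono exp_ge_add_one_self) simp
    also have "\<dots> = exp (- (l * s))"
      unfolding exp_add[symmetric] by (simp add: algebra_simps)
    finally show ?thesis by (simp add: algebra_simps)
  qed
  have "expectation (\<lambda>x. 1 - exp (- (l * a x)))
      \<le> expectation (\<lambda>x. 1 - exp (- (l * m)) + exp (- (l * m)) * (l * (a x - m)))"
  proof (rule integral_mono)
    show "integrable M (\<lambda>x. 1 - exp (- (l * a x)))"
      using a(2) \<open>0 \<le> l\<close> by (intro integrable_const_bound[where B = 1]) auto
    show "integrable M (\<lambda>x. 1 - exp (- (l * m)) + exp (- (l * m)) * (l * (a x - m)))"
      using a(1) by simp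
  qed (rule tangent)
  also have "\<dots> = 1 - exp (- (l * m)) + exp (- (l * m)) * (l * (expectation a - m))"
    using a by (simp add: prob_space)
  also have "\<dots> \<le> 1 - exp (- (l * m))"
    using assms(3,4) by (simp add: mult_nonneg_nonpos)
  finally show ?thesis .
qed

section \<open>Hitting events of the Poisson process\<close>

context marked_poisson_process
begin

definition hit :: "((real^2) \<times> real) set \<Rightarrow> 'w set" where
  "hit A = {\<omega> \<in> space P. eta \<omega> \<inter> A \<noteq> {}}"

lemma hit_mono: "A \<subseteq> B \<Longrightarrow> hit A \<subseteq> hit B"
  unfolding hit_def by auto

lemma hit_UN: "hit (\<Union>i\<in>I. A i) = (\<Union>i\<in>I. hit (A i))"
  unfolding hit_def by auto

text \<open>Boundedness makes the intersection finite, so \<open>card\<close> equal to 0 really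
  means that it is empty.\<close>

lemma bounded_hit_eq:
  "bounded A \<Longrightarrow> hit A = space P - {\<omega> \<in> space P. card (eta \<omega> \<inter> A) = 0}"
  unfolding hit_def using locally_finite by auto

lemma count_event:
  assumes "A \<in> sets borel" "bounded A"
  shows "{\<omega> \<in> space P. card (eta \<omega> \<inter> A) = k} \<in> events"
proof -
  note [measurable] = count_measurable[OF assms]
  show ?thesis by measurable
qed

lemma hit_event:
  assumes "A \<in> sets borel"
  shows "hit A \<in> events"
proof -
  \<comment> \<open>Counts are measurable for bounded sets, so \<open>A\<close> is exhausted by
    countably many bounded pieces.\<close>
  have A: "A = (\<Union>n::nat. A \<inter> cball 0 (real n))"
    using real_arch_simple by fastforce
  have "hit (A \<inter> cball 0 (real n)) \<in> events" for n :: nat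
    using assms
    by (subst bounded_hit_eq) (auto intro!: count_event sets.Diff bounded_Int)
  then show ?thesis by (subst A, subst hit_UN) auto
qed

lemma prob_hit:
  assumes "A \<in> sets borel" "bounded A" "A \<subseteq> UNIV \<times> {0..1}"
  shows "prob (hit A) = 1 - exp (- (lam * measure lborel A))"
  using assms count_poisson[OF assms, of 0] by (simp add: bounded_hit_eq prob_compl count_event)

end

text \<open>The mark interval has length 1, so forgetting the marks leaves intensity
  \<open>lam\<close> in the plane.\<close>

lemma measure_lborel_Times_unit:
  fixes C :: "(real^2) set"
  assumes "C \<in> sets borel"
  shows "measure lborel (C \<times> {0..1::real}) = measure lborel C"
proof -
  have "emeasure lborel (C \<times> {0..1::real}) = emeasure lborel C * emeasure lborel {0..1::real}"
    unfolding lborel_prod[symmetric] using assms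
    by (intro lborel.emeasure_pair_measure_Times) auto
  then show ?thesis by (simp add: measure_def)
qed

section \<open>One-point marginals of the field\<close>

context random_field
begin

lemma measurable_phi_pair [measurable]:
  "(\<lambda>p. phi (fst p) (snd p)) \<in> borel_measurable (Q \<Otimes>\<^sub>M borel)"
  using jointly_measurable by (simp add: case_prod_beta')

lemma measurable_phi [measurable]: "(\<lambda>\<omega>. phi \<omega> x) \<in> borel_measurable Q"
  using measurable_compose[OF measurable_Pair2'[of x borel Q] measurable_phi_pair] by simp

lemma measurable_path:
  "\<omega> \<in> space Q \<Longrightarrow> phi \<omega> \<in> borel_measurable borel"
  using measurable_compose[OF measurable_Pair1'[of \<omega> Q borel] measurable_phi_pair] by simp

text \<open>The case \<open>I = {0}\<close> of stationarity with shift vector \<open>- x\<close>,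
  since \<open>shift (- x) f 0 = f x\<close>. The coordinate map at 0 carries the one-point product
  laws to the line.\<close>

lemma stationary_distr:
  assumes stationary
  shows "distr Q borel (\<lambda>\<omega>. phi \<omega> x) = distr Q borel (\<lambda>\<omega>. phi \<omega> 0)"
proof -
  let ?E = "\<Pi>\<^sub>M x\<in>{0::real^2}. (borel :: real measure)"
  have "distr (distr Q ?E (\<lambda>\<omega>. restrict (shift (- x) (phi \<omega>)) {0})) borel (\<lambda>f. f 0)
      = distr (distr Q ?E (\<lambda>\<omega>. restrict (phi \<omega>) {0})) borel (\<lambda>f. f 0)"
    using assms unfolding stationary_def by simp
  then show ?thesis
    by (subst (asm) (1 2) distr_distr)
      (auto simp: comp_def shift_def intro!: measurable_restrict)
qed

text \<open>One half of the quantile transform. If \<open>z\<close> exceeds the probability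
  \<open>q\<close> of a value below \<open>d\<close>, then \<open>z \<le> marginal_cdf y\<close>
  forces \<open>d \<le> y\<close>, so the quantile at \<open>z\<close> is at least \<open>d\<close>.
  Such marks have total length \<open>1 - q\<close>.\<close>

lemma prob_phi_ge_le_quantile:
  assumes stationary
  shows "emeasure Q {\<omega> \<in> space Q. d \<le> phi \<omega> x}
    \<le> emeasure lborel {z \<in> {0..1}. ereal d \<le> quantile marginal_cdf z}"
proof -
  define q where "q = prob {\<omega> \<in> space Q. phi \<omega> 0 < d}"
  have q: "0 \<le> q" "q \<le> 1" by (auto simp: q_def)
  have distr: "emeasure (distr Q borel (\<lambda>\<omega>. phi \<omega> y)) {d..} = emeasure Q {\<omega> \<in> space Q. d \<le> phi \<omega> y}" for y
    using emeasure_distr[OF measurable_phi, of "{d..}"]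
    by (simp add: vimage_def Int_def conj_commute)
  have "emeasure Q {\<omega> \<in> space Q. d \<le> phi \<omega> x} = emeasure Q {\<omega> \<in> space Q. d \<le> phi \<omega> 0}"
    unfolding distr[symmetric] stationary_distr[OF assms, of x] ..
  also have "{\<omega> \<in> space Q. d \<le> phi \<omega> 0} = space Q - {\<omega> \<in> space Q. phi \<omega> 0 < d}"
    by auto
  also have "emeasure Q \<dots> = ennreal (1 - q)"
    by (simp add: emeasure_eq_measure prob_compl q_def)
  \<comment> \<open>The endpoint \<open>q\<close> is left out because the distribution function may
    already reach \<open>q\<close> at a point below \<open>d\<close>.\<close>
  also have "\<dots> = emeasure lborel {q<..1}"
    using q by simp
  also have "\<dots> \<le> emeasure lborel {z \<in> {0..1}. ereal d \<le> quantile marginal_cdf z}"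
  proof (rule emeasure_mono)
    show "{q<..1} \<subseteq> {z \<in> {0..1}. ereal d \<le> quantile marginal_cdf z}"
    proof
      fix z assume z: "z \<in> {q<..1}"
      have "d \<le> y" if "z \<le> marginal_cdf y" for y
      proof (rule ccontr)
        assume "\<not> d \<le> y"
        have "marginal_cdf y = prob {\<omega> \<in> space Q. phi \<omega> 0 \<le> y}"
          unfolding marginal_cdf_def cdf_def
          using measure_distr[OF measurable_phi, of "{..y}"]
          by (simp add: vimage_def Int_def conj_commute)
        also have "\<dots> \<le> q"
          unfolding q_def using \<open>\<not> d \<le> y\<close> by (intro finite_measure_mono) auto
        finally show False using z that by simp
      qed
      then show "z \<in> {z \<in> {0..1}. ereal d \<le> quantile marginal_cdf z}"
        using z q by (auto simp: quantile_def intro!: Inf_greatest)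
    qed
  qed measurable
  finally show ?thesis .
qed

end

section \<open>Regions of hitting points in bounded windows\<close>

text \<open>Abstracts the geometry: \<open>d\<close> will be the distance to \<open>K\<close>, and
  \<open>D\<close> the complement of \<open>K'\<close>.\<close>

locale coverage =
  pp: marked_poisson_process P lam eta + rf: random_field Q S phi
  for P :: "'w measure" and Q :: "'v measure"
    and lam :: real and eta :: "'w \<Rightarrow> ((real^2) \<times> real) set"
    and S :: "(real^2 \<Rightarrow> real) set" and phi :: "'v \<Rightarrow> real^2 \<Rightarrow> real" +
  fixes d :: "real^2 \<Rightarrow> real" and D :: "(real^2) set"
  assumes stationary: "rf.stationary"
    and measurable_d [measurable]: "d \<in> borel_measurable borel"
    and sets_D [measurable]: "D \<in> sets borel"
begin

text \<open>Planar, because the field ignores the marks; the factor \<open>{0..1}\<close> is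
  attached when the process is evaluated.\<close>

definition field_region :: "nat \<Rightarrow> 'v \<Rightarrow> (real^2) set" where
  "field_region n \<omega> = {x \<in> D \<inter> cball 0 (real n). d x \<le> phi \<omega> x}"

definition quantile_region :: "nat \<Rightarrow> ((real^2) \<times> real) set" where
  "quantile_region n = {p. fst p \<in> D \<inter> cball 0 (real n) \<and> snd p \<in> {0..1} \<and>
     ereal (d (fst p)) \<le> quantile rf.marginal_cdf (snd p)}"

lemma sets_cball [measurable]: "cball (0::real^2) r \<in> sets borel"
  by (rule borel_closed) simp

lemma sets_field_region: "\<omega> \<in> space Q \<Longrightarrow> field_region n \<omega> \<in> sets borel"
  unfolding field_region_def
  using rf.measurable_path[measurable] by measurable

lemma bounded_field_region: "bounded (field_region n \<omega>)"
  by (rule bounded_subset[of "cball 0 (real n)"]) (auto simp: field_region_def)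

lemma emeasure_field_region_le:
  "emeasure lborel (field_region n \<omega>) \<le> emeasure lborel (cball (0::real^2) (real n))"
  by (rule emeasure_mono) (auto simp: field_region_def)

lemma emeasure_cball_finite: "emeasure lborel (cball (0::real^2) r) < \<infinity>"
  by (rule emeasure_bounded_finite) simp

lemma emeasure_field_region:
  "emeasure lborel (field_region n \<omega>) = ennreal (measure lborel (field_region n \<omega>))"
  using emeasure_field_region_le[of n \<omega>] emeasure_cball_finite[of "real n"]
  by (intro emeasure_eq_ennreal_measure) auto

lemma sets_quantile_region [measurable]: "quantile_region n \<in> sets borel"
proof -
  have "{p \<in> space (borel \<Otimes>\<^sub>M borel). fst p \<in> D \<inter> cball 0 (real n) \<and> snd p \<in> {0..1} \<and>
      ereal (d (fst p)) \<le> quantile rf.marginal_cdf (snd p)} \<in> sets (borel \<Otimes>\<^sub>M borel)"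
    by measurable
  then have "quantile_region n \<in> sets (borel \<Otimes>\<^sub>M borel)"
    by (simp add: quantile_region_def space_pair_measure)
  then show ?thesis unfolding borel_prod .
qed

lemma quantile_region_subset: "quantile_region n \<subseteq> cball 0 (real n) \<times> {0..1}"
  by (auto simp: quantile_region_def)

lemma bounded_quantile_region: "bounded (quantile_region n)"
  by (rule bounded_subset[OF bounded_Times quantile_region_subset]) auto

lemma sets_joint_region:
  "{p \<in> space (Q \<Otimes>\<^sub>M borel). snd p \<in> field_region n (fst p)} \<in> sets (Q \<Otimes>\<^sub>M borel)"
  unfolding field_region_def by measurable

text \<open>Sections of a product-measurable set have measurable area, and over
  \<open>space Q\<close> the sections of the joint set are the field regions.\<close>

lemma measurable_area [measurable]:
  "(\<lambda>\<omega>. measure lborel (field_region n \<omega>)) \<in> borel_measurable Q"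
proof -
  have "(\<lambda>\<omega>. emeasure lborel (Pair \<omega> -` {p \<in> space (Q \<Otimes>\<^sub>M borel). snd p \<in> field_region n (fst p)}))
      \<in> borel_measurable Q"
    by (rule lborel.measurable_emeasure_Pair)
      (use sets_joint_region in \<open>simp cong: sets_pair_measure_cong\<close>)
  then have "(\<lambda>\<omega>. emeasure lborel (field_region n \<omega>)) \<in> borel_measurable Q"
    by (rule measurable_cong[THEN iffD1, rotated])
      (auto simp: space_pair_measure intro!: arg_cong[where f = "emeasure lborel"])
  then show ?thesis unfolding measure_def by measurable
qed

lemma integrable_area: "integrable Q (\<lambda>\<omega>. measure lborel (field_region n \<omega>))"
proof (rule rf.integrable_const_bound[where B = "measure lborel (cball (0::real^2) (real n))"])
  show "AE \<omega> in Q. norm (measure lborel (field_region n \<omega>)) \<le> measure lborel (cball (0::real^2) (real n))"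
    using emeasure_cball_finite emeasure_field_region_le
    by (intro always_eventually) (auto simp: measure_def intro!: enn2real_mono)
qed simp

text \<open>The joint set \<open>?W\<close> is sliced in two ways. Slices at a fixed outcome give
  the mean area; slices at a fixed \<open>x\<close> are one-point probabilities, bounded by the
  length of the marks above \<open>x\<close> in \<open>quantile_region n\<close>.\<close>

lemma expected_area_le:
  "rf.expectation (\<lambda>\<omega>. measure lborel (field_region n \<omega>)) \<le> measure lborel (quantile_region n)"
proof -
  interpret Ql: pair_sigma_finite Q "lborel :: (real^2) measure" ..
  let ?W = "{p \<in> space (Q \<Otimes>\<^sub>M borel). snd p \<in> field_region n (fst p)}"
  have W: "?W \<in> sets (Q \<Otimes>\<^sub>M lborel)"
    using sets_joint_region by (simp cong: sets_pair_measure_cong)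
  have R: "quantile_region n \<in> sets (lborel \<Otimes>\<^sub>M lborel)"
    unfolding lborel_prod by simp
  have "ennreal (rf.expectation (\<lambda>\<omega>. measure lborel (field_region n \<omega>)))
      = (\<integral>\<^sup>+\<omega>. emeasure lborel (field_region n \<omega>) \<partial>Q)"
    unfolding emeasure_field_region
    by (rule nn_integral_eq_integral[symmetric]) (auto simp: integrable_area)
  also have "\<dots> = (\<integral>\<^sup>+\<omega>. emeasure lborel (Pair \<omega> -` ?W) \<partial>Q)"
    by (intro nn_integral_cong) (auto simp: space_pair_measure intro!: arg_cong[where f = "emeasure lborel"])
  also have "\<dots> = emeasure (Q \<Otimes>\<^sub>M lborel) ?W"
    by (rule lborel.emeasure_pair_measure_alt[OF W, symmetric])
  also have "\<dots> = (\<integral>\<^sup>+x. emeasure Q ((\<lambda>\<omega>. (\<omega>, x)) -` ?W) \<partial>lborel)"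
    by (rule Ql.emeasure_pair_measure_alt2[OF W])
  also have "\<dots> \<le> (\<integral>\<^sup>+x. emeasure lborel (Pair x -` quantile_region n) \<partial>lborel)"
  proof (rule nn_integral_mono)
    fix x :: "real^2"
    show "emeasure Q ((\<lambda>\<omega>. (\<omega>, x)) -` ?W) \<le> emeasure lborel (Pair x -` quantile_region n)"
    proof (cases "x \<in> D \<inter> cball 0 (real n)")
      case True
      then have "(\<lambda>\<omega>. (\<omega>, x)) -` ?W = {\<omega> \<in> space Q. d x \<le> phi \<omega> x}"
        "Pair x -` quantile_region n = {z \<in> {0..1}. ereal (d x) \<le> quantile rf.marginal_cdf z}"
        by (auto simp: field_region_def quantile_region_def space_pair_measure)
      then show ?thesis using rf.prob_phi_ge_le_quantile[OF stationary] by simp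
    next
      case False
      then have "(\<lambda>\<omega>. (\<omega>, x)) -` ?W = {}" by (auto simp: field_region_def)
      then show ?thesis by (simp only: emeasure_empty zero_le)
    qed
  qed
  also have "\<dots> = emeasure lborel (quantile_region n)"
    using lborel.emeasure_pair_measure_alt[OF R] by (simp add: lborel_prod)
  also have "\<dots> = ennreal (measure lborel (quantile_region n))"
    using emeasure_bounded_finite[OF bounded_quantile_region, of n]
    by (intro emeasure_eq_ennreal_measure) auto
  finally show ?thesis by simp
qed

section \<open>Averaging over the field and removing the windows\<close>

lemma hit_field_region:
  assumes "\<omega> \<in> space Q"
  shows "emeasure P (pp.hit (field_region n \<omega> \<times> {0..1}))
    = ennreal (1 - exp (- (lam * measure lborel (field_region n \<omega>))))"
  using sets_field_region[OF assms] bounded_field_region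
  by (simp add: pp.emeasure_eq_measure pp.prob_hit measure_lborel_Times_unit bounded_Times
      borel_Times Sigma_mono)

text \<open>Concavity is applied with \<open>m\<close> the volume of
  \<open>quantile_region n\<close>, so that the bound is exactly the hitting probability of that
  region.\<close>

lemma nn_integral_hit_field_region_le:
  "(\<integral>\<^sup>+\<omega>. emeasure P (pp.hit (field_region n \<omega> \<times> {0..1})) \<partial>Q)
    \<le> emeasure P (pp.hit (quantile_region n))"
proof -
  let ?a = "\<lambda>\<omega>. measure lborel (field_region n \<omega>)"
  have "(\<integral>\<^sup>+\<omega>. emeasure P (pp.hit (field_region n \<omega> \<times> {0..1})) \<partial>Q)
      = (\<integral>\<^sup>+\<omega>. ennreal (1 - exp (- (lam * ?a \<omega>))) \<partial>Q)"
    by (intro nn_integral_cong hit_field_region)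
  also have "\<dots> = ennreal (rf.expectation (\<lambda>\<omega>. 1 - exp (- (lam * ?a \<omega>))))"
    using pp.intensity_nonneg
    by (intro nn_integral_eq_integral rf.integrable_const_bound[where B = 1]) auto
  also have "\<dots> \<le> ennreal (1 - exp (- (lam * measure lborel (quantile_region n))))"
    using integrable_area expected_area_le pp.intensity_nonneg
    by (intro ennreal_leI rf.expectation_one_minus_exp_le) auto
  also have "\<dots> = emeasure P (pp.hit (quantile_region n))"
    using quantile_region_subset
    by (subst pp.emeasure_eq_measure, subst pp.prob_hit)
      (auto simp: bounded_quantile_region)
  finally show ?thesis .
qed

text \<open>The product-measurable kernel of the event has sections contained in those of the event,
  so joint measurability of the event itself is never needed; if it fails, the left-hand side
  is \<open>0\<close> by convention.\<close>

lemma coverage_prob_le: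
  "measure (completion (P \<Otimes>\<^sub>M Q))
      {(\<omega>, \<omega>') \<in> space (P \<Otimes>\<^sub>M Q). \<exists>(x, z) \<in> eta \<omega>. x \<in> D \<and> d x \<le> phi \<omega>' x}
    \<le> measure P {\<omega> \<in> space P. \<exists>(x, z) \<in> eta \<omega>. x \<in> D \<and> ereal (d x) \<le> quantile rf.marginal_cdf z}"
    (is "measure _ ?E \<le> measure P ?R")
proof (cases "?E \<in> sets (completion (P \<Otimes>\<^sub>M Q))")
  case False
  then show ?thesis by (simp add: measure_notin_sets)
next
  case True
  interpret PQ: pair_sigma_finite P Q ..
  let ?E1 = "main_part (P \<Otimes>\<^sub>M Q) ?E"
  let ?F = "\<lambda>n \<omega>'. field_region n \<omega>' \<times> {0..1::real}"
  have window: "\<exists>n::nat. x \<in> cball 0 (real n)" for x :: "real^2"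
    using real_arch_simple by simp
  have E1: "?E1 \<in> sets (P \<Otimes>\<^sub>M Q)" "?E1 \<subseteq> ?E"
    using main_part_sets[OF True] main_part_null_part_Un[OF True] by (blast, blast)
  have R: "?R = (\<Union>n. pp.hit (quantile_region n))"
  proof (intro equalityI subsetI)
    fix \<omega> assume "\<omega> \<in> ?R"
    then obtain x z where xz: "\<omega> \<in> space P" "(x, z) \<in> eta \<omega>" "x \<in> D"
      "ereal (d x) \<le> quantile rf.marginal_cdf z"
      by blast
    obtain n :: nat where "x \<in> cball 0 (real n)" using window by blast
    moreover have "z \<in> {0..1}" using pp.points_in[OF xz(1)] xz(2) by blast
    ultimately have "(x, z) \<in> eta \<omega> \<inter> quantile_region n"
      using xz unfolding quantile_region_def by simp
    then show "\<omega> \<in> (\<Union>n. pp.hit (quantile_region n))"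
      using xz(1) unfolding pp.hit_def by blast
  next
    fix \<omega> assume "\<omega> \<in> (\<Union>n. pp.hit (quantile_region n))"
    then obtain n x z where "\<omega> \<in> space P" "(x, z) \<in> eta \<omega>" "(x, z) \<in> quantile_region n"
      unfolding pp.hit_def by auto
    then show "\<omega> \<in> ?R" unfolding quantile_region_def by auto
  qed
  have R_sets: "?R \<in> sets P"
    unfolding R by (auto intro!: pp.hit_event)
  have F_sets: "?F n \<omega>' \<in> sets borel" if "\<omega>' \<in> space Q" for n \<omega>'
    using sets_field_region[OF that] by (simp add: borel_Times)
  have F_mono: "?F m \<omega>' \<subseteq> ?F n \<omega>'" if "m \<le> n" for m n \<omega>'
    using subset_cball[of "real m" "real n" "0::real^2"] that unfolding field_region_def by auto
  have "emeasure (completion (P \<Otimes>\<^sub>M Q)) ?E = emeasure (P \<Otimes>\<^sub>M Q) ?E1"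
    using True by simp
  \<comment> \<open>The field is integrated last: each section is then an event of the point process
    for a frozen field. Independence is built into the product measure.\<close>
  also have "\<dots> = (\<integral>\<^sup>+\<omega>'. emeasure P ((\<lambda>\<omega>. (\<omega>, \<omega>')) -` ?E1) \<partial>Q)"
    by (rule PQ.emeasure_pair_measure_alt2[OF E1(1)])
  \<comment> \<open>For a frozen field the section is covered by the hits in growing windows, and
    continuity from below turns their union into a supremum.\<close>
  also have "\<dots> \<le> (\<integral>\<^sup>+\<omega>'. (SUP n. emeasure P (pp.hit (?F n \<omega>'))) \<partial>Q)"
  proof (rule nn_integral_mono)
    fix \<omega>' assume \<omega>': "\<omega>' \<in> space Q"
    have "emeasure P ((\<lambda>\<omega>. (\<omega>, \<omega>')) -` ?E1) \<le> emeasure P (\<Union>n. pp.hit (?F n \<omega>'))"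
    proof (rule emeasure_mono)
      have "\<omega> \<in> (\<Union>n. pp.hit (?F n \<omega>'))" if "(\<omega>, \<omega>') \<in> ?E" for \<omega>
      proof -
        from that obtain x z where xz: "\<omega> \<in> space P" "(x, z) \<in> eta \<omega>" "x \<in> D" "d x \<le> phi \<omega>' x"
          by (auto simp: space_pair_measure)
        obtain n :: nat where "x \<in> cball 0 (real n)" using window by blast
        moreover have "z \<in> {0..1}" using pp.points_in[OF xz(1)] xz(2) by blast
        ultimately have "(x, z) \<in> eta \<omega> \<inter> ?F n \<omega>'"
          using xz(2-4) unfolding field_region_def by simp
        then have "\<omega> \<in> pp.hit (?F n \<omega>')" using xz(1) unfolding pp.hit_def by blast
        then show ?thesis by (rule UN_I[OF UNIV_I])
      qed
      then show "(\<lambda>\<omega>. (\<omega>, \<omega>')) -` ?E1 \<subseteq> (\<Union>n. pp.hit (?F n \<omega>'))"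
        using subsetD[OF E1(2)] by (intro subsetI) (simp only: vimage_eq)
      show "(\<Union>n. pp.hit (?F n \<omega>')) \<in> sets P"
        using F_sets[OF \<omega>'] by (auto intro!: pp.hit_event)
    qed
    also have "\<dots> = (SUP n. emeasure P (pp.hit (?F n \<omega>')))"
      using F_sets[OF \<omega>'] F_mono
      by (intro SUP_emeasure_incseq[symmetric] incseq_SucI pp.hit_mono)
        (auto intro!: pp.hit_event)
    finally show "emeasure P ((\<lambda>\<omega>. (\<omega>, \<omega>')) -` ?E1) \<le> (SUP n. emeasure P (pp.hit (?F n \<omega>')))" .
  qed
  also have "\<dots> = (SUP n. \<integral>\<^sup>+\<omega>'. emeasure P (pp.hit (?F n \<omega>')) \<partial>Q)"
  proof (rule nn_integral_monotone_convergence_SUP_AE)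
    \<comment> \<open>The almost-everywhere form restricts attention to \<open>space Q\<close>,
      where the field regions are known to be Borel.\<close>
    show "AE \<omega>' in Q. emeasure P (pp.hit (?F n \<omega>')) \<le> emeasure P (pp.hit (?F (Suc n) \<omega>'))" for n
      using F_sets F_mono
      by (intro AE_I2 emeasure_mono pp.hit_mono pp.hit_event) auto
    \<comment> \<open>Measurability in the field is read off from the formula in terms of the
      area.\<close>
    have "(\<lambda>\<omega>'. ennreal (1 - exp (- (lam * measure lborel (field_region n \<omega>'))))) \<in> borel_measurable Q" for n
      by measurable
    then show "(\<lambda>\<omega>'. emeasure P (pp.hit (?F n \<omega>'))) \<in> borel_measurable Q" for n
      by (rule measurable_cong[THEN iffD1, rotated])
       (simp add: hit_field_region)
  qed
  also have "\<dots> \<le> emeasure P ?R"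
    using R_sets unfolding R
    by (intro SUP_least order_trans[OF nn_integral_hit_field_region_le] emeasure_mono) auto
  finally have "emeasure (completion (P \<Otimes>\<^sub>M Q)) ?E \<le> emeasure P ?R" .
  then show ?thesis
    unfolding measure_def by (intro enn2real_mono) (auto simp: pp.emeasure_eq_measure)
qed

end

theorem proposition5:
  fixes P :: "'w measure" and Q :: "'v measure"
    and lam :: real and eta :: "'w \<Rightarrow> ((real^2) \<times> real) set"
    and S :: "(real^2 \<Rightarrow> real) set" and phi :: "'v \<Rightarrow> real^2 \<Rightarrow> real"
    and K K' :: "(real^2) set"
  assumes "marked_poisson_process P lam eta"
    and "random_field Q S phi"
    and "random_field.stationary Q phi"
    and "random_field.ergodic Q S phi"
    and "compact K" and "compact K'"
  shows "measure (completion (P \<Otimes>\<^sub>M Q))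
           {(\<omega>, \<omega>') \<in> space (P \<Otimes>\<^sub>M Q).
              \<exists>(x, z) \<in> eta \<omega>. x \<notin> K' \<and> cball x (phi \<omega>' x) \<inter> K \<noteq> {}}
         \<le> measure P
           {\<omega> \<in> space P.
              \<exists>(x, z) \<in> eta \<omega>. x \<notin> K' \<and>
                ecball x (quantile (random_field.marginal_cdf Q phi) z) \<inter> K \<noteq> {}}"
\<comment> \<open>For empty \<open>K\<close> both events are empty, but the distance criterion fails
  there, so this case is split off.\<close>
proof (cases "K = {}")
  case True
  then show ?thesis by simp
next
  case False
  have K: "closed K" using assms(5) by (rule compact_imp_closed)
  interpret pp: marked_poisson_process P lam eta by fact
  interpret rf: random_field Q S phi by fact
  interpret coverage P Q lam eta S phi "\<lambda>x. infdist x K" "- K'"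
  proof
    show "rf.stationary" by fact
    show "(\<lambda>x. infdist x K) \<in> borel_measurable borel"
      by (intro borel_measurable_continuous_onI continuous_intros)
    show "- K' \<in> sets borel"
      using compact_imp_closed[OF assms(6)] by (intro borel_open) (simp add: open_Compl)
  qed
  \<comment> \<open>Both disc conditions become distance inequalities, real for \<open>cball\<close>
    and extended real for \<open>ecball\<close>.\<close>
  show ?thesis
    using coverage_prob_le
    by (simp add: cball_Int_nonempty_iff[OF K False] ecball_Int_nonempty_iff[OF K False])
qed

end
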